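(* Let $T\in\mathbb{Z}^d$ be a fixed vector, and let $f:([m]^d)^3\to\{0,1\}$ be defined by $f(x,y,z)=1$ if and only if $x+y+z=T$ (addition in $\mathbb{Z}^d$). Then the three-player number-on-the-forehead protocol for $f$ described in the context is correct: on every input $(x,y,z)\in([m]^d)^3$ it outputs $f(x,y,z)$.
   Context: $m,d\ge 1$ are integers and $[m]=\{1,\dots,m\}$. In the number-on-the-forehead (NOF) model, on input $(x,y,z)$ player 1 sees $y,z$, player 2 sees $x,z$, and player 3 sees $x,y$; the players communicate by writing on a blackboard visible to all. The protocol is as follows. (1) Player 1 computes $v_x=(T-y-z)+2y+3z$. (2) Player 2 computes $v_y=x+2(T-x-z)+3z$. (3) Player 3 computes $v_z=x+2y+3(T-x-y)$. (All computations are in $\mathbb{Z}^d$.) (4) Player 1 writes $\|v_x\|_2^2$ on the blackboard. (5) Player 2 writes $1$ if $\|v_y\|_2^2=\|v_x\|_2^2$ and $0$ otherwise. (6) Player 3 writes $1$ if $\|v_z\|_2^2=\|v_x\|_2^2$ and $0$ otherwise. (7) The protocol outputs $1$ if the last two bits written are both equal to $1$, and $0$ otherwise. *)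

theory Defs
  imports "HOL-Analysis.Analysis"
begin

text \<open>
  Three-player number-on-the-forehead protocols, with inputs \<open>x\<close>, \<open>y\<close>, \<open>z\<close> on the foreheads of
  players 1, 2, 3.  The visibility restriction is enforced by the types: each message is a function
  of the two inputs seen by its writer (in the order of the players who hold them) and of the
  current contents of the blackboard.
\<close>

datatype ('x, 'y, 'z, 'msg) nof_step =
    Player1 "'y \<Rightarrow> 'z \<Rightarrow> 'msg list \<Rightarrow> 'msg"
  | Player2 "'x \<Rightarrow> 'z \<Rightarrow> 'msg list \<Rightarrow> 'msg"
  | Player3 "'x \<Rightarrow> 'y \<Rightarrow> 'msg list \<Rightarrow> 'msg"

fun nof_message :: "'x \<times> 'y \<times> 'z \<Rightarrow> ('x, 'y, 'z, 'msg) nof_step \<Rightarrow> 'msg list \<Rightarrow> 'msg" where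
  "nof_message (x, y, z) (Player1 p) b = p y z b"
| "nof_message (x, y, z) (Player2 p) b = p x z b"
| "nof_message (x, y, z) (Player3 p) b = p x y b"

text \<open>The output depends only on the final blackboard.\<close>

record ('x, 'y, 'z, 'msg, 'out) nof_protocol =
  nof_steps :: "('x, 'y, 'z, 'msg) nof_step list"
  nof_output :: "'msg list \<Rightarrow> 'out"

text \<open>The blackboard lists the messages in the order in which they were written.\<close>

definition nof_blackboard ::
    "('x, 'y, 'z, 'msg, 'out) nof_protocol \<Rightarrow> 'x \<times> 'y \<times> 'z \<Rightarrow> 'msg list" where
  "nof_blackboard P inp = foldl (\<lambda>b s. b @ [nof_message inp s b]) [] (nof_steps P)"

definition nof_run :: "('x, 'y, 'z, 'msg, 'out) nof_protocol \<Rightarrow> 'x \<times> 'y \<times> 'z \<Rightarrow> 'out" where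
  "nof_run P inp = nof_output P (nof_blackboard P inp)"

definition grid :: "nat \<Rightarrow> (int ^ 'd) set" where
  "grid m = {v. \<forall>i. v $ i \<in> {1..int m}}"

text \<open>
  The library norm is not available on integer vectors, so the squared Euclidean norm is
  defined as an integer; the lemma relates it to the norm of the corresponding real vector.
\<close>

definition sq_norm :: "int ^ 'd \<Rightarrow> int" where
  "sq_norm v = (\<Sum>i\<in>UNIV. (v $ i)\<^sup>2)"

lemma of_int_sq_norm:
  fixes v :: "int ^ 'd"
  shows "real_of_int (sq_norm v) = (norm (\<chi> i. real_of_int (v $ i)))\<^sup>2"
  by (simp add: sq_norm_def norm_vec_def L2_set_def sum_nonneg)

definition vec_x :: "int ^ 'd \<Rightarrow> int ^ 'd \<Rightarrow> int ^ 'd \<Rightarrow> int ^ 'd" where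
  "vec_x T y z = (T - y - z) + 2 *s y + 3 *s z"

definition vec_y :: "int ^ 'd \<Rightarrow> int ^ 'd \<Rightarrow> int ^ 'd \<Rightarrow> int ^ 'd" where
  "vec_y T x z = x + 2 *s (T - x - z) + 3 *s z"

definition vec_z :: "int ^ 'd \<Rightarrow> int ^ 'd \<Rightarrow> int ^ 'd \<Rightarrow> int ^ 'd" where
  "vec_z T x y = x + 2 *s y + 3 *s (T - x - y)"

text \<open>
  All messages are integers, bits being written as \<open>0\<close> and \<open>1\<close>.  Entry 0 of the blackboard is
  the number written by player 1, entries 1 and 2 are the bits written by players 2 and 3.
\<close>

definition sum_protocol ::
    "int ^ 'd \<Rightarrow> (int ^ 'd, int ^ 'd, int ^ 'd, int, nat) nof_protocol" where
  "sum_protocol T =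
    \<lparr> nof_steps =
        [ Player1 (\<lambda>y z b. sq_norm (vec_x T y z)),
          Player2 (\<lambda>x z b. if sq_norm (vec_y T x z) = b ! 0 then 1 else 0),
          Player3 (\<lambda>x y b. if sq_norm (vec_z T x y) = b ! 0 then 1 else 0) ],
      nof_output = (\<lambda>b. if b ! 1 = 1 \<and> b ! 2 = 1 then 1 else 0) \<rparr>"

end

theory Submission
  imports Defs
begin

text \<open>
  With \<open>D = T - x - y - z\<close> and \<open>v = x + 2 y + 3 z\<close>, the three vectors of the players are
  \<open>v + D\<close>, \<open>v + 2 D\<close> and \<open>v + 3 D\<close>.  Three points in arithmetic progression have equal Euclidean
  norm only if the common difference \<open>D\<close> vanishes, since a sphere contains no three distinct
  collinear points.
\<close>

lemma sq_norm_eq_0_iff: "sq_norm v = 0 \<longleftrightarrow> v = 0"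
  by (simp add: sq_norm_def sum_nonneg_eq_0_iff vec_eq_iff)

text \<open>Coordinatewise, the cross terms of the two squares cancel.\<close>

lemma sq_norm_parallelogram:
  "sq_norm (v - w) + sq_norm (v + w) = 2 * sq_norm v + 2 * sq_norm w"
  unfolding sq_norm_def sum_distrib_left sum.distrib[symmetric]
  by (rule sum.cong) (auto simp: power2_eq_square algebra_simps)

lemma vec_x_conv_vec_y: "vec_x T y z = vec_y T x z - (T - x - y - z)"
  by (simp add: vec_x_def vec_y_def vec_eq_iff)

lemma vec_z_conv_vec_y: "vec_z T x y = vec_y T x z + (T - x - y - z)"
  by (simp add: vec_z_def vec_y_def vec_eq_iff)

lemma sq_norms_eq_iff:
  "sq_norm (vec_y T x z) = sq_norm (vec_x T y z) \<and> sq_norm (vec_z T x y) = sq_norm (vec_x T y z)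
    \<longleftrightarrow> x + y + z = T"
proof -
  define D where "D = T - x - y - z"
  have D: "D = 0 \<longleftrightarrow> x + y + z = T"
    by (auto simp: D_def algebra_simps)
  \<comment> \<open>Centred at the middle vector \<open>vec_y T x z\<close>; if the three squared
    norms agree, this forces \<open>sq_norm D = 0\<close>.\<close>
  have "sq_norm (vec_x T y z) + sq_norm (vec_z T x y) = 2 * sq_norm (vec_y T x z) + 2 * sq_norm D"
    unfolding vec_x_conv_vec_y[of T y z x] vec_z_conv_vec_y[of T x y z] D_def[symmetric]
    by (rule sq_norm_parallelogram)
  moreover have "vec_x T y z = vec_y T x z" "vec_z T x y = vec_y T x z" if "D = 0"
    using that vec_x_conv_vec_y[of T y z x] vec_z_conv_vec_y[of T x y z] by (simp_all add: D_def)
  ultimately show ?thesis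
    using sq_norm_eq_0_iff[of D] D by auto
qed

lemma nof_run_sum_protocol:
  "nof_run (sum_protocol T) (x, y, z) = (if x + y + z = T then 1 else 0)"
  \<comment> \<open>This turns the condition on the sum into the two bit tests, so evaluating the
    protocol suffices.\<close>
  unfolding sq_norms_eq_iff[symmetric]
  by (simp add: nof_run_def nof_blackboard_def sum_protocol_def)

theorem lemma20:
  fixes T :: "int ^ 'd" and m :: nat
    and f :: "(int ^ 'd) \<times> (int ^ 'd) \<times> (int ^ 'd) \<Rightarrow> nat"
  assumes "m \<ge> 1"
    and "f \<in> grid m \<times> grid m \<times> grid m \<rightarrow> {0, 1}"
    and "\<And>x y z. x \<in> grid m \<Longrightarrow> y \<in> grid m \<Longrightarrow> z \<in> grid m \<Longrightarrow> f (x, y, z) = 1 \<longleftrightarrow> x + y + z = T"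
  shows "\<forall>(x, y, z) \<in> grid m \<times> grid m \<times> grid m. nof_run (sum_protocol T) (x, y, z) = f (x, y, z)"
proof clarify
  fix x y z :: "int ^ 'd"
  assume xyz: "x \<in> grid m" "y \<in> grid m" "z \<in> grid m"
  \<comment> \<open>The range of \<open>f\<close> settles its value as 0 where it is not 1.\<close>
  then have "f (x, y, z) \<in> {0, 1}"
    using assms(2) by blast
  then show "nof_run (sum_protocol T) (x, y, z) = f (x, y, z)"
    using assms(3)[OF xyz] by (auto simp: nof_run_sum_protocol)
qed

end
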